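(* For every integer $k\ge 1$ there exists a constant $C_k>0$, depending only on $k$, such that for every polynomial $P_k$ of degree $k$ with integer coefficients, every $a\in\mathbb{Z}$, every nonzero $q\in\mathbb{Z}$ and every integer $N\ge 1$, $$\left|\{t\in\mathbb{Z}:\ P_k(t)\in\{a+q,a+2q,\ldots,a+Nq\}\}\right|\le C_k\, d(q)^{k-1}N^{1/k}.$$
   Context: For a nonzero integer $q$, $d(q)$ denotes the number of (positive) divisors of $q$. For a finite set $S$, $|S|$ denotes its cardinality. *)

theory Defs
  imports Complex_Main "HOL-Computational_Algebra.Polynomial"
begin

(* Intended for q \<noteq> 0; for q = 0 the set of divisors is infinite and the value is 0. *)
definition divisor_count :: "int \<Rightarrow> nat" where
  "divisor_count q = card {m :: int. 0 < m \<and> m dvd q}"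

end

theory Submission
  imports Defs
begin

text \<open>
  Replacing \<open>P\<close> by \<open>P - a\<close>, one counts the integers \<open>t\<close> at which a polynomial of degree \<open>k\<close> with
  leading coefficient \<open>c\<close> takes a value divisible by \<open>q\<close> and of size at most \<open>N \<bar>q\<bar>\<close>.
  Put \<open>q' = \<bar>q\<bar> / gcd c q\<close>.

  The arithmetic half of the argument splits the solutions into at most \<open>d(q) ^ (k - 1)\<close>
  classes, in each of which all differences are divisible by one integer \<open>D\<close> with \<open>D ^ k \<ge> q'\<close>.
  Fix a solution \<open>u\<close> and factor \<open>P(t) - P(u) = (t - u) Q(t)\<close>, where \<open>Q\<close> again has leading
  coefficient \<open>c\<close>.  On the class \<open>gcd (t - u) q = d\<close> all \<open>t\<close> agree modulo \<open>d\<close>, and \<open>Q(t)\<close> is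
  divisible by \<open>q / d\<close>.  Either \<open>d\<close> is already large enough to serve as \<open>D\<close>, or \<open>q / d\<close> is
  so large that one can go on with \<open>Q\<close>, which has smaller degree.  After \<open>k - 1\<close> splittings the
  polynomial is linear and determines \<open>t\<close> modulo the remaining modulus over its gcd with \<open>c\<close>.
  This is \<open>card_le_if_dvd_poly\<close>.

  The analytic half bounds one class.  If it has more than \<open>k s\<close> elements, then \<open>k + 1\<close> of
  them are pairwise at least \<open>D s\<close> apart, and Lagrange interpolation at these nodes gives
  \<open>\<bar>c\<bar> (D s) ^ k \<le> (k + 1) N \<bar>q\<bar>\<close> (\<open>lead_coeff_bound_spaced\<close>).  Since
  \<open>\<bar>c\<bar> D ^ k \<ge> gcd c q * q' = \<bar>q\<bar>\<close>, this forces \<open>s ^ k \<le> (k + 1) N\<close>.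
  A class therefore has at most a constant times \<open>N powr (1 / k)\<close> elements.
  The bound is independent of the coefficients because a small \<open>\<bar>c\<bar>\<close>, which permits long
  ranges of \<open>t\<close>, also makes the gcd small and so the spacing \<open>D\<close> large.
\<close>

section \<open>Leading coefficients and values at well-spaced points\<close>

text \<open>The polynomial on the right-hand side of Lagrange's interpolation formula agrees with \<open>p\<close>
  at \<open>k + 1\<close> points and is therefore \<open>p\<close>; compare the coefficients of degree \<open>k\<close>.\<close>

lemma coeff_eq_sum_lagrange:
  fixes p :: "'a :: field poly"
  assumes fin: "finite A" and card: "card A = Suc k" and deg: "degree p \<le> k"
  shows "coeff p k = (\<Sum>a\<in>A. poly p a / (\<Prod>b\<in>A - {a}. a - b))"
proof -
  define l where "l a = (\<Prod>b\<in>A - {a}. [:- b, 1:])" for a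
  define w where "w a = (\<Prod>b\<in>A - {a}. a - b)" for a
  define r where "r = (\<Sum>a\<in>A. smult (poly p a / w a) (l a))"
  have deg_l: "degree (l a) = k" if "a \<in> A" for a
    using that fin card by (simp add: l_def degree_prod_eq_sum_degree)
  have coeff_l: "coeff (l a) k = 1" if "a \<in> A" for a
  proof -
    have "lead_coeff (l a) = 1"
      by (simp add: l_def lead_coeff_prod)
    thus ?thesis using deg_l[OF that] by simp
  qed
  have poly_l: "poly (l a) x = (if x = a then w a else 0)" if "a \<in> A" "x \<in> A" for a x
    using that fin by (auto simp: l_def w_def poly_prod)
  have w_nz: "w a \<noteq> 0" if "a \<in> A" for a
    using that fin by (auto simp: w_def)
  have poly_r: "poly p x = poly r x" if "x \<in> A" for x
  proof -
    have "poly r x = (\<Sum>a\<in>A. if x = a then poly p a else 0)"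
      unfolding r_def poly_sum
      by (intro sum.cong refl) (use that poly_l w_nz in auto)
    thus ?thesis using that fin by simp
  qed
  have "degree r \<le> k"
    unfolding r_def by (intro degree_sum_le fin order.trans[OF degree_smult_le]) (simp add: deg_l)
  hence "p = r"
    using poly_r deg card by (intro poly_eqI_degree[of A]) auto
  hence "coeff p k = coeff r k" by simp
  also have "\<dots> = (\<Sum>a\<in>A. poly p a / w a)"
    unfolding r_def coeff_sum by (intro sum.cong refl) (simp add: coeff_l)
  finally show ?thesis by (simp add: w_def)
qed

lemma lead_coeff_bound_separated:
  fixes p :: "real poly"
  assumes fin: "finite A" and card: "card A = Suc (degree p)"
    and L: "L > 0" and sep: "\<And>a b. a \<in> A \<Longrightarrow> b \<in> A \<Longrightarrow> a \<noteq> b \<Longrightarrow> L \<le> \<bar>a - b\<bar>"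
    and val: "\<And>a. a \<in> A \<Longrightarrow> \<bar>poly p a\<bar> \<le> M"
  shows "\<bar>lead_coeff p\<bar> * L ^ degree p \<le> (real (degree p) + 1) * M"
proof -
  have term_le: "\<bar>poly p a / (\<Prod>b\<in>A - {a}. a - b)\<bar> \<le> M / L ^ degree p" if a: "a \<in> A" for a
  proof -
    have "L ^ degree p = (\<Prod>b\<in>A - {a}. L)"
      using a card fin by simp
    also have "\<dots> \<le> (\<Prod>b\<in>A - {a}. \<bar>a - b\<bar>)"
      by (rule prod_mono) (use a L sep in auto)
    finally have "L ^ degree p \<le> \<bar>\<Prod>b\<in>A - {a}. a - b\<bar>"
      by (simp add: abs_prod)
    moreover have "0 \<le> M" using val[OF a] by linarith
    ultimately show ?thesis
      unfolding abs_divide by (intro frac_le val a) (use L in auto)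
  qed
  have "\<bar>lead_coeff p\<bar> \<le> (\<Sum>a\<in>A. \<bar>poly p a / (\<Prod>b\<in>A - {a}. a - b)\<bar>)"
    unfolding coeff_eq_sum_lagrange[OF fin card order.refl] by (rule sum_abs)
  also have "\<dots> \<le> (\<Sum>a\<in>A. M / L ^ degree p)"
    by (intro sum_mono term_le)
  also have "\<dots> = (real (degree p) + 1) * M / L ^ degree p"
    by (simp add: card algebra_simps)
  finally show ?thesis
    using L by (simp add: pos_le_divide_eq)
qed

text \<open>In increasing order, neighbours in \<open>T\<close> differ by at least \<open>D\<close>, so taking every \<open>s\<close>-th
  element yields points with mutual distance at least \<open>D s\<close>.\<close>

lemma obtain_spaced_subset:
  fixes T :: "int set" and D :: int and s k :: nat
  assumes fin: "finite T" and D: "D > 0" and s: "s > 0"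
    and dvd: "\<And>x y. x \<in> T \<Longrightarrow> y \<in> T \<Longrightarrow> D dvd x - y"
    and card: "card T > k * s"
  obtains A where "A \<subseteq> T" "card A = Suc k"
    "\<And>x y. x \<in> A \<Longrightarrow> y \<in> A \<Longrightarrow> x \<noteq> y \<Longrightarrow> D * int s \<le> \<bar>x - y\<bar>"
proof -
  define xs where "xs = sorted_list_of_set T"
  have set_xs: "set xs = T" and len: "length xs = card T" and sorted: "sorted_wrt (<) xs"
    using fin by (simp_all add: xs_def)
  have gap: "xs ! i + D * int j \<le> xs ! (i + j)" if "i + j < card T" for i j
    using that
  proof (induction j)
    case 0
    then show ?case by simp
  next
    case (Suc j)
    have "xs ! (i + j) < xs ! (i + Suc j)"
      using Suc.prems len by (intro sorted_wrt_nth_less[OF sorted]) auto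
    moreover have "D dvd xs ! (i + Suc j) - xs ! (i + j)"
      by (rule dvd) (use Suc.prems len in \<open>simp_all flip: set_xs\<close>)
    ultimately have "D \<le> xs ! (i + Suc j) - xs ! (i + j)"
      by (intro zdvd_imp_le) auto
    with Suc show ?case by (simp add: algebra_simps)
  qed
  define f where "f i = xs ! (i * s)" for i
  have idx: "i * s < card T" if "i \<le> k" for i
    using mult_le_mono1[OF that, of s] card by linarith
  have f_gap: "f i + D * int s \<le> f j" if "i < j" "j \<le> k" for i j
  proof -
    have le: "i * s + s \<le> j * s"
      using mult_le_mono1[of "Suc i" j s] that by simp
    have "i * s + (j * s - i * s) = j * s" using le by simp
    hence "f i + D * int (j * s - i * s) \<le> f j"
      using gap[of "i * s" "j * s - i * s"] idx[OF that(2)] unfolding f_def by simp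
    moreover have "D * int s \<le> D * int (j * s - i * s)"
      by (rule mult_left_mono) (use le D in auto)
    ultimately show ?thesis by linarith
  qed
  have f_sep: "D * int s \<le> \<bar>f i - f j\<bar>" if "i \<noteq> j" "i \<le> k" "j \<le> k" for i j
    using f_gap[of i j] f_gap[of j i] that by (cases "i < j") auto
  have "inj_on f {..k}"
  proof (rule inj_onI, rule ccontr)
    fix i j assume "i \<in> {..k}" "j \<in> {..k}" "f i = f j" "i \<noteq> j"
    with f_sep[of i j] have "D * int s \<le> 0" by simp
    moreover have "0 < D * int s" using D s by simp
    ultimately show False by simp
  qed
  hence "card (f ` {..k}) = Suc k" by (simp add: card_image)
  moreover have "f ` {..k} \<subseteq> T"
    using idx len by (auto simp: f_def simp flip: set_xs)
  ultimately show ?thesis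
    by (intro that[of "f ` {..k}"]) (auto intro!: f_sep)
qed

lemma lead_coeff_bound_spaced:
  fixes p :: "int poly" and T :: "int set" and D :: int and M :: real
  assumes fin: "finite T" and D: "D > 0" and s: "s > 0"
    and dvd: "\<And>x y. x \<in> T \<Longrightarrow> y \<in> T \<Longrightarrow> D dvd x - y"
    and val: "\<And>t. t \<in> T \<Longrightarrow> \<bar>real_of_int (poly p t)\<bar> \<le> M"
    and card: "card T > degree p * s"
  shows "\<bar>real_of_int (lead_coeff p)\<bar> * (real_of_int D * real s) ^ degree p
           \<le> (real (degree p) + 1) * M"
proof -
  obtain A where A: "A \<subseteq> T" "card A = Suc (degree p)"
    and sep: "\<And>x y. x \<in> A \<Longrightarrow> y \<in> A \<Longrightarrow> x \<noteq> y \<Longrightarrow> D * int s \<le> \<bar>x - y\<bar>"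
    using obtain_spaced_subset[OF fin D s dvd card] by blast
  define p' where "p' = map_poly real_of_int p"
  have deg: "degree p' = degree p" and lc: "lead_coeff p' = real_of_int (lead_coeff p)"
    by (simp_all add: p'_def degree_map_poly coeff_map_poly)
  have poly: "poly p' (real_of_int x) = real_of_int (poly p x)" for x
    unfolding p'_def by (induction p) (simp_all add: map_poly_pCons)
  have sep': "real_of_int D * real s \<le> \<bar>real_of_int x - real_of_int y\<bar>"
    if "x \<in> A" "y \<in> A" "x \<noteq> y" for x y
    using sep[OF that]
    by (metis of_int_abs of_int_diff of_int_le_iff of_int_mult of_int_of_nat_eq)
  have "\<bar>lead_coeff p'\<bar> * (real_of_int D * real s) ^ degree p' \<le> (real (degree p') + 1) * M"
  proof (rule lead_coeff_bound_separated)
    show "finite (real_of_int ` A)" using A fin by (auto intro: finite_subset)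
    show "card (real_of_int ` A) = Suc (degree p')"
      using A deg by (simp add: card_image inj_on_def)
  qed (use A D s val sep' poly in auto)
  thus ?thesis unfolding lc unfolding deg .
qed

section \<open>Splitting the solutions of a polynomial congruence\<close>

lemma dvd_mult_imp_div_gcd_dvd:
  fixes q c x :: int
  assumes "q > 0" and "q dvd c * x"
  shows "q div gcd c q dvd x"
proof -
  define g where "g = gcd c q"
  have g: "g \<noteq> 0" and c: "c = g * (c div g)" and q: "q = g * (q div g)"
    using assms by (simp_all add: g_def)
  have "coprime (q div g) (c div g)"
    using assms unfolding g_def by (simp add: coprime_commute div_gcd_coprime)
  moreover have "g * (q div g) dvd g * (c div g * x)"
    using assms(2) c q by (metis mult.assoc)
  hence "q div g dvd c div g * x" using g by simp
  ultimately show ?thesis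
    unfolding g_def by (simp add: coprime_dvd_mult_right_iff)
qed

lemma finite_pos_divisors:
  fixes q :: int
  assumes "q \<noteq> 0"
  shows "finite {m. 0 < m \<and> m dvd q}"
  using finite_divisors_int[OF assms] by (rule rev_finite_subset) auto

lemma divisor_count_pos: "q \<noteq> 0 \<Longrightarrow> divisor_count q > 0"
  unfolding divisor_count_def using finite_pos_divisors[of q]
  by (subst card_gt_0_iff) (auto intro: exI[of _ 1])

lemma divisor_count_mono:
  assumes "d dvd q" and "q \<noteq> 0"
  shows "divisor_count d \<le> divisor_count q"
  unfolding divisor_count_def using assms finite_pos_divisors[of q]
  by (intro card_mono) (auto intro: dvd_trans)

text \<open>Iterated splitting by greatest common divisors.  The threshold \<open>X\<close> stands for
  the root of \<open>q / gcd c q\<close> of order \<open>degree Q\<close> in the initial situation; it stays fixed along the induction, while the degree and the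
  modulus shrink.  If a class has common divisor \<open>d < X\<close>, then passing from \<open>q\<close> to \<open>q / d\<close> costs
  less than one factor \<open>X\<close>, which the drop of the degree by one compensates.
  The bound \<open>B\<close> for sets with large common spacing is kept abstract because that spacing arises
  at different depths of the splitting.\<close>

lemma card_le_if_dvd_poly:
  fixes Q :: "int poly" and q :: int and S :: "int set" and X :: real and B n :: nat
  assumes "finite S" and "q > 0" and "degree Q = Suc n"
    and "\<And>t. t \<in> S \<Longrightarrow> q dvd poly Q t"
    and "X > 0"
    and "X ^ Suc n * real_of_int (gcd (lead_coeff Q) q) \<le> real_of_int q"
    and "\<And>T D. \<lbrakk>T \<subseteq> S; D > 0; X \<le> real_of_int D;
                \<And>x y. x \<in> T \<Longrightarrow> y \<in> T \<Longrightarrow> D dvd x - y\<rbrakk> \<Longrightarrow> card T \<le> B"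
  shows "card S \<le> divisor_count q ^ n * B"
  using assms
proof (induction n arbitrary: Q q S)
  case 0
  define c where "c = lead_coeff Q"
  obtain b c' where Q: "Q = [:b, c':]"
    using "0.prems"(3) degree1_coeffs[of Q] by (metis One_nat_def)
  have c: "c' = c" using Q "0.prems"(3) by (auto simp: c_def)
  define D where "D = q div gcd c q"
  have q: "q = D * gcd c q" by (simp add: D_def)
  have g: "gcd c q > 0" using \<open>q > 0\<close> by simp
  have "D > 0" using \<open>q > 0\<close> q g by (metis zero_less_mult_pos2)
  moreover have "X \<le> real_of_int D"
  proof -
    have "X * real_of_int (gcd c q) \<le> real_of_int D * real_of_int (gcd c q)"
      using "0.prems"(6) q by (simp add: c_def flip: of_int_mult)
    thus ?thesis using g by (simp add: mult_le_cancel_right_pos)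
  qed
  moreover have "D dvd x - y" if "x \<in> S" "y \<in> S" for x y
  proof -
    have "q dvd poly Q x - poly Q y" using "0.prems"(4) that by (intro dvd_diff) auto
    also have "poly Q x - poly Q y = c * (x - y)" by (simp add: Q c algebra_simps)
    finally show ?thesis unfolding D_def using \<open>q > 0\<close> by (intro dvd_mult_imp_div_gcd_dvd)
  qed
  ultimately show ?case using "0.prems"(7)[of S D] by simp
next
  case (Suc n)
  note q_pos = \<open>q > 0\<close> and X_pos = \<open>X > 0\<close> and spaced = Suc.prems(7)
  show ?case
  proof (cases "S = {}")
    case False
    then obtain u where u: "u \<in> S" by blast
    have "poly (Q - [:poly Q u:]) u = 0" by simp
    then obtain R where "Q - [:poly Q u:] = [:- u, 1:] * R"
      by (metis poly_eq_0_iff_dvd dvd_def)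
    hence Q: "Q = [:- u, 1:] * R + [:poly Q u:]" by (simp add: algebra_simps)
    have "R \<noteq> 0" using Q Suc.prems(3) by (metis degree_pCons_0 mult_zero_right add_0 nat.distinct(1))
    hence deg_prod: "degree ([:- u, 1:] * R) = Suc (degree R)" by (subst degree_mult_eq) simp_all
    have "degree Q = degree ([:- u, 1:] * R)"
      by (subst Q) (rule degree_add_eq_left, unfold deg_prod, simp)
    hence deg_R: "degree R = Suc n" using deg_prod Suc.prems(3) by simp
    have lc: "lead_coeff Q = lead_coeff R"
    proof -
      have "coeff Q (Suc (Suc n)) = coeff ([:- u, 1:] * R) (Suc (Suc n))"
        by (subst Q) simp
      also have "\<dots> = lead_coeff ([:- u, 1:] * R)" by (simp only: deg_prod deg_R)
      also have "\<dots> = lead_coeff R" by (simp only: lead_coeff_mult) simp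
      finally show ?thesis by (simp add: Suc.prems(3))
    qed
    define c where "c = lead_coeff Q"
    have dvd_prod: "q dvd (t - u) * poly R t" if "t \<in> S" for t
    proof -
      have "q dvd poly Q t - poly Q u" using that u Suc.prems(4) by (intro dvd_diff) auto
      also have "poly Q t - poly Q u = (t - u) * poly R t" by (subst Q) (simp add: algebra_simps)
      finally show ?thesis .
    qed

    define Ds where "Ds = {m :: int. 0 < m \<and> m dvd q}"
    define Sd where "Sd d = {t \<in> S. gcd (t - u) q = d}" for d
    have fin_Ds: "finite Ds" using finite_pos_divisors[of q] q_pos by (simp add: Ds_def)
    have class_le: "card (Sd d) \<le> divisor_count q ^ n * B" if "d \<in> Ds" for d
    proof (cases "X \<le> real_of_int d")
      case True
      have "d dvd x - y" if "x \<in> Sd d" "y \<in> Sd d" for x y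
      proof -
        have "d dvd t - u" if "t \<in> Sd d" for t using that by (auto simp: Sd_def)
        from this[OF that(1)] this[OF that(2)]
        have "d dvd (x - u) - (y - u)" by (rule dvd_diff)
        thus ?thesis by simp
      qed
      hence "card (Sd d) \<le> B"
        using spaced[of "Sd d" d] True \<open>d \<in> Ds\<close> by (auto simp: Sd_def Ds_def)
      also have "1 * B \<le> divisor_count q ^ n * B"
        using divisor_count_pos[of q] q_pos by (intro mult_le_mono1) (simp add: Suc_leI)
      hence "B \<le> divisor_count q ^ n * B" by simp
      finally show ?thesis .
    next
      case False
      define e where "e = q div d"
      have d: "0 < d" "d dvd q" using that by (auto simp: Ds_def)
      have q: "q = d * e" using d by (simp add: e_def)
      have e: "e > 0" using q q_pos d by (simp add: zero_less_mult_iff)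
      have "card (Sd d) \<le> divisor_count e ^ n * B"
      proof (rule Suc.IH)
        show "finite (Sd d)" using Suc.prems(1) by (simp add: Sd_def)
        show "e dvd poly R t" if "t \<in> Sd d" for t
          using dvd_mult_imp_div_gcd_dvd[OF q_pos dvd_prod, of t] that by (auto simp: Sd_def e_def)
        show "X ^ Suc n * real_of_int (gcd (lead_coeff R) e) \<le> real_of_int e"
        proof -
          have "gcd c e \<le> gcd c q"
            using q_pos q by (intro zdvd_imp_le gcd_mono) auto
          hence "X ^ Suc (Suc n) * real_of_int (gcd c e) \<le> X ^ Suc (Suc n) * real_of_int (gcd c q)"
            using X_pos by (intro mult_left_mono) auto
          also have "\<dots> \<le> real_of_int d * real_of_int e"
            using Suc.prems(6) q by (simp add: c_def flip: of_int_mult)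
          also have "\<dots> \<le> X * real_of_int e"
            using False e by (intro mult_right_mono) auto
          finally have "X * (X ^ Suc n * real_of_int (gcd c e)) \<le> X * real_of_int e"
            by (simp add: mult.assoc)
          thus ?thesis using X_pos lc by (simp only: mult_le_cancel_left_pos c_def)
        qed
        show "card T \<le> B" if "T \<subseteq> Sd d" "D > 0" "X \<le> real_of_int D"
            "\<And>x y. x \<in> T \<Longrightarrow> y \<in> T \<Longrightarrow> D dvd x - y" for T D
          using that by (intro spaced[of T D]) (auto simp: Sd_def)
      qed (use e deg_R X_pos in auto)
      also have "\<dots> \<le> divisor_count q ^ n * B"
        using divisor_count_mono[of e q] q d e by (intro mult_le_mono1 power_mono) auto
      finally show ?thesis .
    qed

    have "S = (\<Union>d\<in>Ds. Sd d)" using q_pos by (auto simp: Ds_def Sd_def)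
    hence "card S \<le> (\<Sum>d\<in>Ds. card (Sd d))" using card_UN_le[OF fin_Ds, of Sd] by simp
    also have "\<dots> \<le> (\<Sum>d\<in>Ds. divisor_count q ^ n * B)" by (intro sum_mono class_le)
    also have "\<dots> = divisor_count q ^ Suc n * B" by (simp add: Ds_def divisor_count_def)
    finally show ?thesis .
  qed simp
qed

section \<open>Polynomial values in an arithmetic progression\<close>

lemma finite_poly_preimage:
  fixes P :: "'a :: {comm_ring_1, ring_no_zero_divisors} poly"
  assumes "finite V" and "degree P > 0"
  shows "finite {t. poly P t \<in> V}"
proof -
  have "finite {t. poly P t = v}" for v
  proof -
    have "P - [:v:] \<noteq> 0" using assms(2) by auto
    from poly_roots_finite[OF this] show ?thesis by simp
  qed
  hence "finite (\<Union>v\<in>V. {t. poly P t = v})" using assms(1) by blast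
  also have "(\<Union>v\<in>V. {t. poly P t = v}) = {t. poly P t \<in> V}" by blast
  finally show ?thesis .
qed

text \<open>The factor \<open>\<bar>q\<bar>\<close> in the bound for the values cancels against
  \<open>\<bar>c\<bar> D ^ k \<ge> \<bar>q\<bar>\<close>, which leaves a condition on \<open>s\<close> that involves only \<open>k\<close> and \<open>N\<close>.\<close>

lemma card_small_multiples_le:
  fixes Q :: "int poly" and q :: int and S :: "int set"
  assumes fin: "finite S" and q: "q > 0" and deg: "degree Q > 0"
    and dvd: "\<And>t. t \<in> S \<Longrightarrow> q dvd poly Q t"
    and val: "\<And>t. t \<in> S \<Longrightarrow> \<bar>real_of_int (poly Q t)\<bar> \<le> real N * real_of_int q"
    and s: "real s ^ degree Q > (real (degree Q) + 1) * real N"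
  shows "card S \<le> divisor_count q ^ (degree Q - 1) * (degree Q * s)"
proof -
  define k where "k = degree Q"
  define c where "c = lead_coeff Q"
  have k: "k > 0" using deg by (simp add: k_def)
  have c: "c \<noteq> 0" using deg by (auto simp: c_def)
  have g: "gcd c q > 0" using q by simp
  have "0 \<le> (real k + 1) * real N" by simp
  hence "real s ^ k > 0" using s unfolding k_def by linarith
  hence s_pos: "s > 0" using k by (cases "s = 0") (auto simp: zero_power)
  define X where "X = root k (real_of_int q / real_of_int (gcd c q))"
  have X_pos: "X > 0" using q g k by (simp add: X_def)
  have X_pow: "X ^ k = real_of_int q / real_of_int (gcd c q)"
    using q g k by (simp add: X_def)
  have X_gcd: "X ^ k * real_of_int (gcd c q) = real_of_int q"
    using g X_pow by (simp add: field_simps)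
  have "card S \<le> divisor_count q ^ (k - 1) * (k * s)"
  proof (rule card_le_if_dvd_poly[where Q = Q and X = X])
    show "X ^ Suc (k - 1) * real_of_int (gcd (lead_coeff Q) q) \<le> real_of_int q"
      using X_gcd k by (simp add: c_def)
  next
    fix T D assume T: "T \<subseteq> S" and D: "D > 0" "X \<le> real_of_int D"
      and dvd_T: "\<And>x y. x \<in> T \<Longrightarrow> y \<in> T \<Longrightarrow> D dvd x - y"
    show "card T \<le> k * s"
    proof (rule ccontr)
      assume "\<not> card T \<le> k * s"
      hence bound: "\<bar>real_of_int c\<bar> * (real_of_int D * real s) ^ k
          \<le> (real k + 1) * (real N * real_of_int q)"
        using lead_coeff_bound_spaced[of T D s Q "real N * real_of_int q"] T D dvd_T s_pos fin val
        by (auto simp: k_def c_def intro: finite_subset)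
      have "gcd c q \<le> \<bar>c\<bar>" using c by (intro zdvd_imp_le) auto
      hence gc: "real_of_int (gcd c q) \<le> \<bar>real_of_int c\<bar>" by linarith
      have "real_of_int q * real s ^ k = real_of_int (gcd c q) * (X * real s) ^ k"
        using X_gcd by (simp add: power_mult_distrib mult_ac flip: X_gcd)
      also have "\<dots> \<le> \<bar>real_of_int c\<bar> * (real_of_int D * real s) ^ k"
        using gc D X_pos by (intro mult_mono power_mono mult_right_mono) auto
      also note bound
      finally have "real_of_int q * real s ^ k \<le> real_of_int q * ((real k + 1) * real N)"
        by (simp add: mult_ac)
      hence "real s ^ k \<le> (real k + 1) * real N" using q by simp
      thus False using s by (simp add: k_def)
    qed
  qed (use fin q dvd X_pos k in \<open>auto simp: k_def\<close>)
  thus ?thesis by (simp add: k_def)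
qed

theorem theorem0p1:
  fixes k :: nat
  assumes "k \<ge> 1"
  shows "\<exists>C :: real. C > 0 \<and>
    (\<forall>(P :: int poly) (a :: int) (q :: int) (N :: nat).
      degree P = k \<longrightarrow> q \<noteq> 0 \<longrightarrow> N \<ge> 1 \<longrightarrow>
        finite {t :: int. poly P t \<in> {a + int j * q | j. j \<in> {1..N}}} \<and>
        real (card {t :: int. poly P t \<in> {a + int j * q | j. j \<in> {1..N}}})
          \<le> C * real (divisor_count q) ^ (k - 1) * real N powr (1 / real k))"
proof (intro exI[of _ "2 * real k * (real k + 1)"] conjI allI impI)
  show "2 * real k * (real k + 1) > 0" using assms by simp
next
  fix P :: "int poly" and a q :: int and N :: nat
  assume deg: "degree P = k" and q: "q \<noteq> 0" and N: "N \<ge> 1"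
  have "finite {a + int j * q | j. j \<in> {1..N}}" by simp
  from finite_poly_preimage[OF this, of P]
  show "finite {t :: int. poly P t \<in> {a + int j * q | j. j \<in> {1..N}}}"
    using deg assms by simp
next
  fix P :: "int poly" and a q :: int and N :: nat
  assume deg: "degree P = k" and q: "q \<noteq> 0" and N: "N \<ge> 1"
  define S where "S = {t :: int. poly P t \<in> {a + int j * q | j. j \<in> {1..N}}}"
  define Q where "Q = P - [:a:]"
  define y where "y = real N powr (1 / real k)"
  have y: "y = root k (real N)" using N assms by (simp add: y_def root_powr_inverse)
  have y1: "y \<ge> 1" using N assms by (simp add: y)
  \<comment> \<open>The spare factor \<open>k + 1\<close> in \<open>s\<close> absorbs the factor \<open>k + 1\<close> of the interpolation bound.\<close>
  define s where "s = (k + 1) * (nat \<lfloor>y\<rfloor> + 1)"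
  have floor: "y < real (nat \<lfloor>y\<rfloor> + 1)" "real (nat \<lfloor>y\<rfloor> + 1) \<le> 2 * y"
    using y1 by linarith+
  have s_le: "real s \<le> 2 * (real k + 1) * y"
    using mult_left_mono[OF floor(2), of "real k + 1"] by (simp add: s_def algebra_simps)
  have "degree P = degree (P + (- [:a:]))"
    by (rule degree_add_eq_left[symmetric]) (use deg assms in simp)
  hence deg_Q: "degree Q = k" using deg by (simp only: Q_def diff_conv_add_uminus)
  have val: "\<exists>j\<in>{1..N}. poly Q t = int j * q" if "t \<in> S" for t
    using that by (auto simp: S_def Q_def)
  have "card S \<le> divisor_count \<bar>q\<bar> ^ (degree Q - 1) * (degree Q * s)"
  proof (rule card_small_multiples_le)
    have "finite {a + int j * q | j. j \<in> {1..N}}" by simp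
    from finite_poly_preimage[OF this, of P] show "finite S"
      using deg assms by (simp add: S_def)
    show "\<bar>q\<bar> > 0" using q by simp
    show "degree Q > 0" using deg_Q assms by simp
    show "\<bar>q\<bar> dvd poly Q t" if "t \<in> S" for t
      using val[OF that] by auto
    show "\<bar>real_of_int (poly Q t)\<bar> \<le> real N * real_of_int \<bar>q\<bar>" if "t \<in> S" for t
      using val[OF that] by (auto simp: abs_mult intro!: mult_right_mono)
    have "(real k + 1) * real N = (real k + 1) * y ^ k"
      using assms by (simp add: y)
    also have "\<dots> < (real k + 1) * real (nat \<lfloor>y\<rfloor> + 1) ^ k"
      using floor(1) y1 assms by (intro mult_strict_left_mono power_strict_mono) auto
    also have "\<dots> \<le> (real k + 1) ^ k * real (nat \<lfloor>y\<rfloor> + 1) ^ k"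
      using assms by (intro mult_right_mono self_le_power) auto
    also have "\<dots> = real s ^ k"
      unfolding s_def power_mult_distrib[symmetric] by (simp add: algebra_simps)
    finally show "(real (degree Q) + 1) * real N < real s ^ degree Q"
      by (simp add: deg_Q)
  qed
  also have "divisor_count \<bar>q\<bar> = divisor_count q" by (simp add: divisor_count_def)
  finally have "card S \<le> divisor_count q ^ (k - 1) * (k * s)" by (simp add: deg_Q)
  hence "real (card S) \<le> real (divisor_count q ^ (k - 1) * (k * s))"
    by (simp only: of_nat_le_iff)
  also have "\<dots> = real (divisor_count q) ^ (k - 1) * real k * real s" by simp
  also have "\<dots> \<le> real (divisor_count q) ^ (k - 1) * real k * (2 * (real k + 1) * y)"
    by (intro mult_left_mono s_le) auto
  also have "\<dots> = 2 * real k * (real k + 1) * real (divisor_count q) ^ (k - 1) * y"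
    by simp
  finally show "real (card {t :: int. poly P t \<in> {a + int j * q | j. j \<in> {1..N}}})
      \<le> 2 * real k * (real k + 1) * real (divisor_count q) ^ (k - 1) * real N powr (1 / real k)"
    by (simp add: S_def y_def)
qed

end
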